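(* For $c\in[-2,2]$ let $$F_c(z)=\frac{z}{1+cz+z^2},\qquad \omega(z)=z^2,$$ and let $f_c=h_c+\overline{g_c}:\mathbb{D}\to\mathbb{C}$ be the harmonic mapping satisfying $h_c-g_c=F_c$ and $g_c'=\omega h_c'$, with $h_c,g_c$ analytic on $\mathbb{D}$ and normalized by $h_c(0)=g_c(0)=g_c'(0)=h_c'(0)-1=0$. Then: (i) $f_c\in S_H^0$ and $f_c(\mathbb{D})$ is convex in the horizontal direction. (ii) $f_0(\mathbb{D})$ is an infinite vertical strip, $f_2(\mathbb{D})$ is the complex plane minus a single slit along the positive real axis, and $f_{-2}(\mathbb{D})$ is the complex plane minus a single slit along the negative real axis (so that, as $c$ varies from $0$ to $2$, $f_c(\mathbb{D})$ transforms from the strip to the domain slit along the positive real axis, and, as $c$ varies from $-2$ to $0$, from the domain slit along the negative real axis to the strip). (iii) $f_c$ lifts to a minimal graph $X_c$ on $\mathbb{D}$; that is, $$X_c(z)=\left(\operatorname{Re}\{h_c(z)+g_c(z)\},\ \operatorname{Im}\{h_c(z)-g_c(z)\},\ 2\operatorname{Im}\left\{\int_0^z \zeta\,h_c'(\zeta)\,d\zeta\right\}\right),\qquad z\in\mathbb{D},$$ parametrizes a minimal graph over $f_c(\mathbb{D})$. (iv) $X_{-2}(\mathbb{D})$ is part of Enneper's surface, $X_0(\mathbb{D})$ is part of the helicoid, and $X_2(\mathbb{D})$ is part of Enneper's surface.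
   Context: $\mathbb{D}=\{z\in\mathbb{C}:|z|<1\}$. $S_H^0$ is the family of harmonic univalent mappings $f=h+\overline g:\mathbb{D}\to\mathbb{C}$ with $h,g$ analytic on $\mathbb{D}$ and $h(0)=g(0)=0$, $h'(0)=1$, $g'(0)=0$. A domain is convex in the horizontal direction if its intersection with every line parallel to the real axis is connected. A vertical strip is a set $\{w:\alpha<\operatorname{Re}w<\beta\}$ with $\alpha<\beta$ real. The plane slit along the positive (resp. negative) real axis means $\mathbb{C}\setminus[t,\infty)$ for some $t>0$ (resp. $\mathbb{C}\setminus(-\infty,t]$ for some $t<0$). A minimal surface is a surface in $\mathbb{R}^3$ whose mean curvature vanishes at every point. A minimal graph over a domain $\Omega\subset\mathbb{C}$ is a minimal surface of the form $\{(u,v,G(u,v)):u+iv\in\Omega\}$ with $G:\Omega\to\mathbb{R}$. A harmonic univalent map $f=h+\overline g$ whose dilatation $g'/h'$ is the square of an analytic function is lifted by the Weierstrass–Enneper parametrization $\left(\operatorname{Re}\{h+g\},\operatorname{Im}\{h-g\},2\operatorname{Im}\int_0^z\sqrt{g'h'}\,d\zeta\right)$; here $\sqrt{g_c'h_c'}=\zeta h_c'(\zeta)$. The helicoid is the surface parametrized by $$Y_0(z)=\left(\operatorname{Re}\left(z-\tfrac1z\right),\ \operatorname{Im}\left(z+\tfrac1z\right),\ 2\operatorname{Im}(\log z)\right),\qquad z\in\mathbb{C}\setminus(-\infty,0],$$ with $\log$ the principal branch. Enneper's surface is the surface parametrized by $$Y_2(z)=\left(\operatorname{Re}\left(z-\tfrac{z^3}{3}\right),\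 \operatorname{Im}\left(z+\tfrac{z^3}{3}\right),\ \operatorname{Re}(-z^2)\right),\qquad z\in\mathbb{C}.$$ "Is part of" one of these surfaces means: is mapped onto a subset of that surface by some similarity of $\mathbb{R}^3$ (a composition of translations, rotations, reflections, including permutations of coordinates, and scaling by a nonzero factor). *)

theory Defs
  imports "HOL-Complex_Analysis.Complex_Analysis"
begin

section \<open>Harmonic mappings of the unit disk\<close>

text \<open>
  Functions on the disk are total functions on \<open>complex\<close>; only their values on
  \<open>ball 0 1\<close> matter.
\<close>

definition S_H_0 :: "(complex \<Rightarrow> complex) set" where
  "S_H_0 = {f. inj_on f (ball 0 1) \<and>
     (\<exists>h g. h holomorphic_on ball 0 1 \<and> g holomorphic_on ball 0 1 \<and>
        (\<forall>z\<in>ball 0 1. f z = h z + cnj (g z)) \<and>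
        h 0 = 0 \<and> g 0 = 0 \<and> deriv h 0 = 1 \<and> deriv g 0 = 0)}"

definition convex_in_horizontal_direction :: "complex set \<Rightarrow> bool" where
  "convex_in_horizontal_direction \<Omega> \<longleftrightarrow>
     open \<Omega> \<and> connected \<Omega> \<and> (\<forall>y. connected (\<Omega> \<inter> {w. Im w = y}))"

definition vertical_strip :: "complex set \<Rightarrow> bool" where
  "vertical_strip \<Omega> \<longleftrightarrow> (\<exists>\<alpha> \<beta>. \<alpha> < \<beta> \<and> \<Omega> = {w. \<alpha> < Re w \<and> Re w < \<beta>})"

definition plane_slit_positive :: "complex set \<Rightarrow> bool" where
  "plane_slit_positive \<Omega> \<longleftrightarrow> (\<exists>t>0. \<Omega> = - (complex_of_real ` {t..}))"

definition plane_slit_negative :: "complex set \<Rightarrow> bool" where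
  "plane_slit_negative \<Omega> \<longleftrightarrow> (\<exists>t<0. \<Omega> = - (complex_of_real ` {..t}))"

definition F_c :: "real \<Rightarrow> complex \<Rightarrow> complex" where
  "F_c c z = z / (1 + of_real c * z + z\<^sup>2)"

definition horizontal_shear ::
  "(complex \<Rightarrow> complex) \<Rightarrow> (complex \<Rightarrow> complex) \<Rightarrow> (complex \<Rightarrow> complex) \<Rightarrow> (complex \<Rightarrow> complex) \<Rightarrow> bool"
  where
  "horizontal_shear \<phi> \<omega> h g \<longleftrightarrow>
     h holomorphic_on ball 0 1 \<and> g holomorphic_on ball 0 1 \<and>
     (\<forall>z\<in>ball 0 1. h z - g z = \<phi> z) \<and>
     (\<forall>z\<in>ball 0 1. deriv g z = \<omega> z * deriv h z) \<and>
     h 0 = 0 \<and> g 0 = 0 \<and> deriv g 0 = 0 \<and> deriv h 0 = 1"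

definition harmonic_map :: "(complex \<Rightarrow> complex) \<Rightarrow> (complex \<Rightarrow> complex) \<Rightarrow> complex \<Rightarrow> complex" where
  "harmonic_map h g z = h z + cnj (g z)"

text \<open>
  The Weierstrass--Enneper lift when \<open>g' = \<zeta>\<^sup>2 h'\<close>, i.e. with
  \<open>\<zeta> h'(\<zeta>)\<close> as the branch of \<open>sqrt (g' h')\<close>.
\<close>

definition lift :: "(complex \<Rightarrow> complex) \<Rightarrow> (complex \<Rightarrow> complex) \<Rightarrow> complex \<Rightarrow> real^3" where
  "lift h g z = vector
     [Re (h z + g z),
      Im (h z - g z),
      2 * Im (contour_integral (linepath 0 z) (\<lambda>\<zeta>. \<zeta> * deriv h \<zeta>))]"


section \<open>Minimal surfaces in space\<close>

text \<open>
  Parameter domains are open subsets of \<open>complex\<close>, viewed as the real plane with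
  coordinates \<open>u = Re z\<close> and \<open>v = Im z\<close>.
\<close>

definition pd_u :: "(complex \<Rightarrow> 'a::real_normed_vector) \<Rightarrow> complex \<Rightarrow> 'a" where
  "pd_u X z = vector_derivative (\<lambda>t. X (z + of_real t)) (at 0)"

definition pd_v :: "(complex \<Rightarrow> 'a::real_normed_vector) \<Rightarrow> complex \<Rightarrow> 'a" where
  "pd_v X z = vector_derivative (\<lambda>t. X (z + \<i> * of_real t)) (at 0)"

fun Ck_on :: "nat \<Rightarrow> (complex \<Rightarrow> 'a::real_normed_vector) \<Rightarrow> complex set \<Rightarrow> bool" where
  "Ck_on 0 X U \<longleftrightarrow> continuous_on U X"
| "Ck_on (Suc k) X U \<longleftrightarrow>
     (\<forall>z\<in>U. X differentiable (at z)) \<and> Ck_on k (pd_u X) U \<and> Ck_on k (pd_v X) U"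

definition smooth_on :: "(complex \<Rightarrow> 'a::real_normed_vector) \<Rightarrow> complex set \<Rightarrow> bool" where
  "smooth_on X U \<longleftrightarrow> (\<forall>k. Ck_on k X U)"

definition local_parametrization :: "(complex \<Rightarrow> real^3) \<Rightarrow> complex set \<Rightarrow> (real^3) set \<Rightarrow> bool" where
  "local_parametrization X U S \<longleftrightarrow>
     open U \<and> smooth_on X U \<and>
     (\<forall>z\<in>U. cross3 (pd_u X z) (pd_v X z) \<noteq> 0) \<and>
     openin (top_of_set S) (X ` U) \<and>
     (\<exists>Y. homeomorphism U (X ` U) X Y)"

definition unit_normal :: "(complex \<Rightarrow> real^3) \<Rightarrow> complex \<Rightarrow> real^3" where
  "unit_normal X z =
     cross3 (pd_u X z) (pd_v X z) /\<^sub>R norm (cross3 (pd_u X z) (pd_v X z))"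

text \<open>\<open>(e G - 2 f F + g E) / (2 (E G - F\<^sup>2))\<close> in terms of the coefficients of the
  first fundamental form (\<open>E, F, G\<close>) and of the second (\<open>e, f, g\<close>).\<close>

definition mean_curvature :: "(complex \<Rightarrow> real^3) \<Rightarrow> complex \<Rightarrow> real" where
  "mean_curvature X z =
     (let E1 = pd_u X z \<bullet> pd_u X z;
          F1 = pd_u X z \<bullet> pd_v X z;
          G1 = pd_v X z \<bullet> pd_v X z;
          e2 = pd_u (pd_u X) z \<bullet> unit_normal X z;
          f2 = pd_u (pd_v X) z \<bullet> unit_normal X z;
          g2 = pd_v (pd_v X) z \<bullet> unit_normal X z
      in (e2 * G1 - 2 * f2 * F1 + g2 * E1) / (2 * (E1 * G1 - F1\<^sup>2)))"

text \<open>
  Up to sign, the mean curvature at a point does not depend on the local parametrization,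
  so its vanishing may be tested on any one of them. The definition entails that \<open>S\<close> is a
  regular (embedded) surface.
\<close>

definition minimal_surface :: "(real^3) set \<Rightarrow> bool" where
  "minimal_surface S \<longleftrightarrow>
     (\<forall>p\<in>S. \<exists>X U. local_parametrization X U S \<and> p \<in> X ` U \<and> (\<forall>z\<in>U. mean_curvature X z = 0))"

definition minimal_graph :: "complex set \<Rightarrow> (real^3) set \<Rightarrow> bool" where
  "minimal_graph \<Omega> S \<longleftrightarrow>
     open \<Omega> \<and> connected \<Omega> \<and> \<Omega> \<noteq> {} \<and> minimal_surface S \<and>
     (\<exists>G :: complex \<Rightarrow> real. S = (\<lambda>w. vector [Re w, Im w, G w]) ` \<Omega>)"

definition parametrizes :: "(complex \<Rightarrow> real^3) \<Rightarrow> complex set \<Rightarrow> (real^3) set \<Rightarrow> bool" where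
  "parametrizes X U S \<longleftrightarrow> local_parametrization X U S \<and> X ` U = S"


section \<open>The helicoid and Enneper's surface\<close>

definition Y0 :: "complex \<Rightarrow> real^3" where
  "Y0 z = vector [Re (z - 1 / z), Im (z + 1 / z), 2 * Im (Ln z)]"

definition helicoid :: "(real^3) set" where
  "helicoid = Y0 ` (- (complex_of_real ` {..0}))"

definition Y2 :: "complex \<Rightarrow> real^3" where
  "Y2 z = vector [Re (z - z ^ 3 / 3), Im (z + z ^ 3 / 3), Re (- z\<^sup>2)]"

definition enneper :: "(real^3) set" where
  "enneper = range Y2"

definition similarity :: "(real^3 \<Rightarrow> real^3) \<Rightarrow> bool" where
  "similarity T \<longleftrightarrow>
     (\<exists>a k R. k \<noteq> 0 \<and> orthogonal_transformation R \<and> T = (\<lambda>x. a + k *\<^sub>R R x))"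

definition is_part_of :: "(real^3) set \<Rightarrow> (real^3) set \<Rightarrow> bool" where
  "is_part_of S M \<longleftrightarrow> (\<exists>T. similarity T \<and> T ` S \<subseteq> M)"

end

theory Submission
  imports Defs
begin

text \<open>
  The shear is given by \<open>h' = 1 / (1 + cz + z\<^sup>2)\<^sup>2\<close> and \<open>g' = z\<^sup>2 h'\<close>. Since \<open>1 / F\<^sub>c = z + 1 / z + c\<close>,
  the function \<open>F\<^sub>c\<close> is injective, and its image meets each horizontal line in a connected set. On such a
  section \<open>Im f = Im F\<^sub>c\<close> is constant and \<open>Re f = Re (h + g)\<close> strictly increases with \<open>Re F\<^sub>c\<close>, because
  \<open>(h' + g') / F\<^sub>c' = (1 + z\<^sup>2) / (1 - z\<^sup>2)\<close> has positive real part; this is the shear construction, and it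
  gives injectivity and horizontal convexity of \<open>f\<close>. The lift is the real part of a holomorphic null
  curve, hence conformal and harmonic, hence minimal, and a graph because \<open>f\<close> is injective.

  For \<open>c = 0\<close> and \<open>c = 2\<close> everything is explicit in terms of \<open>q = (1 + \<i>z) / (1 - \<i>z)\<close> and
  \<open>w = (1 - z) / (1 + z)\<close>, which map the disk onto the right half plane; \<open>c = -2\<close> reduces to
  \<open>c = 2\<close> by \<open>z \<mapsto> -z\<close>.
\<close>

no_notation fps_nth (infixl \<open>$\<close> 75)

section \<open>Surfaces with holomorphic Weierstrass data\<close>

text \<open>Both partial derivatives are derivatives along lines through z, so the chain rule reads
  them off the total derivative.\<close>

lemma has_derivative_imp_pd:
  assumes "(X has_derivative L) (at z)"
  shows "pd_u X z = L 1" "pd_v X z = L \<i>"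
proof -
  interpret bounded_linear L
    using assms by (rule has_derivative_bounded_linear)
  have lin: "vector_derivative (\<lambda>t. X (z + of_real t * w)) (at 0) = L w" for w
  proof (rule vector_derivative_at)
    have "((\<lambda>t. z + of_real t * w) has_derivative (\<lambda>t. of_real t * w)) (at 0)"
      by (auto intro!: derivative_eq_intros)
    then have "((\<lambda>t. X (z + of_real t * w)) has_derivative (\<lambda>t. L (of_real t * w))) (at 0)"
      using has_derivative_compose[where g = X] assms by fastforce
    then show "((\<lambda>t. X (z + of_real t * w)) has_vector_derivative L w) (at 0)"
      unfolding has_vector_derivative_def by (simp add: scaleR scaleR_conv_of_real[symmetric])
  qed
  show "pd_u X z = L 1" "pd_v X z = L \<i>"
    using lin[of 1] lin[of \<i>] by (simp_all add: pd_u_def pd_v_def mult.commute)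
qed

lemma has_derivative_Re_vec:
  fixes \<Phi> :: "'n::finite \<Rightarrow> complex \<Rightarrow> complex"
  assumes "\<And>i. (\<Phi> i has_field_derivative \<phi> i) (at z)"
  shows "((\<lambda>z. \<chi> i. Re (\<Phi> i z)) has_derivative (\<lambda>d. \<chi> i. Re (\<phi> i * d))) (at z)"
proof -
  have "((\<lambda>z. Re (\<Phi> i z)) has_derivative (\<lambda>d. Re (\<phi> i * d))) (at z)" for i
    using assms[of i] unfolding has_field_derivative_def by (rule has_derivative_Re)
  then show ?thesis
    by (subst has_derivative_componentwise_within) (auto simp: Basis_vec_def inner_axis)
qed

context
  fixes U :: "complex set" and \<Phi> :: "'n::finite \<Rightarrow> complex \<Rightarrow> complex" and X :: "complex \<Rightarrow> real^'n"
  assumes U: "open U"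
    and hol: "\<And>i. \<Phi> i holomorphic_on U"
    and X: "\<And>z. z \<in> U \<Longrightarrow> X z = (\<chi> i. Re (\<Phi> i z))"
begin

lemma has_derivative_Re_holomorphic:
  assumes "z \<in> U"
  shows "(X has_derivative (\<lambda>d. \<chi> i. Re (deriv (\<Phi> i) z * d))) (at z)"
proof (rule has_derivative_transform_within_open[OF _ U assms])
  show "((\<lambda>z. \<chi> i. Re (\<Phi> i z)) has_derivative (\<lambda>d. \<chi> i. Re (deriv (\<Phi> i) z * d))) (at z)"
    by (intro has_derivative_Re_vec holomorphic_derivI[OF hol U assms])
qed (simp add: X)

text \<open>The partials are again real parts of holomorphic curves, with data \<Phi>' and i
  \<Phi>', so the result can be applied to itself for higher derivatives.\<close>

lemma pd_Re_holomorphic: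
  assumes "z \<in> U"
  shows "pd_u X z = (\<chi> i. Re (deriv (\<Phi> i) z))" "pd_v X z = (\<chi> i. Re (\<i> * deriv (\<Phi> i) z))"
  using has_derivative_imp_pd[OF has_derivative_Re_holomorphic[OF assms]]
  by (simp_all add: mult.commute)

end

lemma smooth_on_Re_holomorphic:
  fixes \<Phi> :: "'n::finite \<Rightarrow> complex \<Rightarrow> complex"
  assumes U: "open U" and "\<And>i. \<Phi> i holomorphic_on U"
    and "\<And>z. z \<in> U \<Longrightarrow> X z = (\<chi> i. Re (\<Phi> i z))"
  shows "smooth_on X U"
proof -
  have "Ck_on k X U" for k
    using assms(2,3)
  \<comment> \<open>Passing to a partial derivative replaces both the map and its holomorphic data,
    hence the generalization.\<close>
  proof (induction k arbitrary: X \<Phi>)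
    case 0
    then show ?case
      by (simp only: Ck_on.simps cong: continuous_on_cong)
        (intro continuous_intros holomorphic_on_imp_continuous_on)
  next
    case (Suc k)
    note pd = pd_Re_holomorphic[OF U Suc.prems]
    have "X differentiable (at z)" if "z \<in> U" for z
      using has_derivative_Re_holomorphic[OF U Suc.prems that] by (rule differentiableI)
    moreover have "Ck_on k (pd_u X) U"
      by (rule Suc.IH[where \<Phi> = "\<lambda>i. deriv (\<Phi> i)"])
         (auto simp: pd intro: holomorphic_deriv Suc.prems U)
    moreover have "Ck_on k (pd_v X) U"
      by (rule Suc.IH[where \<Phi> = "\<lambda>i z. \<i> * deriv (\<Phi> i) z"])
         (auto simp: pd intro!: holomorphic_intros holomorphic_deriv Suc.prems U)
    ultimately show ?case by simp
  qed
  then show ?thesis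
    by (simp add: smooth_on_def)
qed

text \<open>A null curve \<open>\<Sum> \<phi>\<^sub>i\<^sup>2 = 0\<close> makes the parametrization conformal; being harmonic as
  well, it satisfies \<open>X\<^sub>u\<^sub>u = - X\<^sub>v\<^sub>v\<close>.\<close>

context
  fixes U :: "complex set" and \<Phi> :: "3 \<Rightarrow> complex \<Rightarrow> complex" and X :: "complex \<Rightarrow> real^3"
  assumes U: "open U"
    and hol: "\<And>i. \<Phi> i holomorphic_on U"
    and X: "\<And>z. z \<in> U \<Longrightarrow> X z = (\<chi> i. Re (\<Phi> i z))"
    and null: "\<And>z. z \<in> U \<Longrightarrow> (\<Sum>i\<in>UNIV. (deriv (\<Phi> i) z)\<^sup>2) = 0"
begin

lemma null_curve_conformal:
  assumes "z \<in> U"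
  shows "pd_u X z \<bullet> pd_v X z = 0" "pd_u X z \<bullet> pd_u X z = pd_v X z \<bullet> pd_v X z"
proof -
  \<comment> \<open>With X_u = (Re \<phi>_i) and X_v = (-Im \<phi>_i), the sum of the squares
    \<phi>_i^2 has real part |X_u|^2 - |X_v|^2 and imaginary part -2 X_u.X_v.\<close>
  show "pd_u X z \<bullet> pd_v X z = 0"
    using arg_cong[OF null[OF assms], of Im]
    by (simp add: pd_Re_holomorphic[OF U hol X assms] sum_3 inner_vec_def power2_eq_square mult.commute)
  show "pd_u X z \<bullet> pd_u X z = pd_v X z \<bullet> pd_v X z"
    using arg_cong[OF null[OF assms], of Re]
    by (simp add: pd_Re_holomorphic[OF U hol X assms] sum_3 inner_vec_def power2_eq_square)
qed

lemma null_curve_mean_curvature: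
  assumes "z \<in> U"
  shows "mean_curvature X z = 0"
proof -
  note pd = pd_Re_holomorphic[OF U hol X]
  have "pd_u (pd_u X) z = (\<chi> i. Re (deriv (deriv (\<Phi> i)) z))"
    by (rule pd_Re_holomorphic[OF U]) (auto simp: pd intro: holomorphic_deriv hol U assms)
  moreover have "pd_v (pd_v X) z = (\<chi> i. Re (\<i> * deriv (\<lambda>z. \<i> * deriv (\<Phi> i) z) z))"
    by (rule pd_Re_holomorphic[OF U])
       (auto simp: pd intro!: holomorphic_intros holomorphic_deriv hol U assms)
  moreover have "deriv (\<lambda>z. \<i> * deriv (\<Phi> i) z) z = \<i> * deriv (deriv (\<Phi> i)) z" for i
    by (rule deriv_cmult) (metis U assms hol holomorphic_deriv holomorphic_on_imp_differentiable_at)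
  ultimately have "pd_v (pd_v X) z = - pd_u (pd_u X) z"
    by (simp add: vec_eq_iff)
  then show ?thesis
    using null_curve_conformal[OF assms] by (simp add: mean_curvature_def)
qed

text \<open>By Lagrange's identity and conformality, a vanishing cross product forces X_u = X_v = 0,
  and then every coordinate derivative vanishes.\<close>

lemma null_curve_regular:
  assumes "z \<in> U" and "deriv (\<Phi> j) z \<noteq> 0"
  shows "cross3 (pd_u X z) (pd_v X z) \<noteq> 0"
proof
  assume "cross3 (pd_u X z) (pd_v X z) = 0"
  with norm_cross_dot[of "pd_u X z" "pd_v X z"] null_curve_conformal[OF assms(1)]
  have "pd_u X z = 0" "pd_v X z = 0"
    by (auto simp: norm_eq_sqrt_inner)
  then have "deriv (\<Phi> j) z = 0"
    by (auto simp: pd_Re_holomorphic[OF U hol X assms(1)] vec_eq_iff complex_eq_iff)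
  with assms(2) show False by simp
qed

end

section \<open>The Cayley transform\<close>

definition cayley :: "complex \<Rightarrow> complex" where
  "cayley z = (1 - z) / (1 + z)"

lemma cayley_cayley:
  assumes "z \<noteq> -1" shows "cayley (cayley z) = z"
proof -
  have "1 + z \<noteq> 0" using assms by (metis add_eq_0_iff)
  then have "1 + cayley z = 2 / (1 + z)" "1 - cayley z = 2 * z / (1 + z)"
    by (simp_all add: cayley_def field_simps)
  with \<open>1 + z \<noteq> 0\<close> show ?thesis by (simp add: cayley_def[of "cayley z"])
qed

lemma Re_cayley: "Re (cayley z) = (1 - (norm z)\<^sup>2) / (norm (1 + z))\<^sup>2"
  \<comment> \<open>At z = -1 both sides are 0, since division by 0 yields 0.\<close>
  by (cases "z = -1")
     (simp_all add: cayley_def Re_divide cmod_power2 field_simps, simp add: power2_eq_square algebra_simps)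

lemma Re_cayley_pos_iff: "Re (cayley z) > 0 \<longleftrightarrow> z \<in> ball 0 1" if "z \<noteq> -1"
proof -
  have "norm (1 + z) > 0" using that by (metis add_eq_0_iff zero_less_norm_iff)
  then show ?thesis
    by (simp add: Re_cayley zero_less_divide_iff abs_square_less_1)
qed

text \<open>The sign criterion \<open>Re_cayley_pos_iff\<close> gives one inclusion; applied to
  \<open>cayley w\<close> it gives the other, because the map is its own inverse.\<close>

lemma cayley_image_ball: "cayley ` ball 0 1 = {w. Re w > 0}"
proof (intro equalityI subsetI)
  fix w assume "w \<in> {w. Re w > 0}"
  then have w: "Re w > 0" by simp
  then have *: "w \<noteq> -1" by auto
  then have "cayley w \<noteq> -1"
    using w by (auto simp: cayley_def divide_eq_eq add_eq_0_iff split: if_splits)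
  then have "cayley w \<in> ball 0 1"
    using Re_cayley_pos_iff[of "cayley w"] w by (simp add: cayley_cayley[OF *])
  then show "w \<in> cayley ` ball 0 1"
    using cayley_cayley[OF *] by (metis imageI)
next
  fix w assume "w \<in> cayley ` ball 0 1"
  then obtain z where "z \<in> ball 0 1" "w = cayley z" by auto
  then show "w \<in> {w. Re w > 0}"
    using Re_cayley_pos_iff[of z] by fastforce
qed

lemma has_field_derivative_cayley:
  assumes "z \<noteq> -1"
  shows "(cayley has_field_derivative - 2 / (1 + z)\<^sup>2) (at z)"
proof -
  have "1 + z \<noteq> 0" using assms by (metis add_eq_0_iff)
  then show ?thesis
    unfolding cayley_def
    by (auto intro!: derivative_eq_intros simp: power2_eq_square)
qed

lemma unimodular_mult_image_ball:
  fixes u :: complex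
  assumes "norm u = 1"
  shows "(\<lambda>z. u * z) ` ball 0 r = ball 0 r"
proof (intro equalityI subsetI)
  fix z :: complex assume "z \<in> ball 0 r"
  then show "z \<in> (\<lambda>z. u * z) ` ball 0 r"
    using assms by (intro image_eqI[of _ _ "z / u"]) (auto simp: norm_divide)
qed (auto simp: norm_mult assms)

lemma cayley_rotated_image_ball: "(\<lambda>z. cayley (- \<i> * z)) ` ball 0 1 = {q. Re q > 0}"
  using unimodular_mult_image_ball[of "- \<i>" 1] image_image[of cayley "\<lambda>z. - \<i> * z" "ball 0 1"]
  by (simp add: cayley_image_ball)

section \<open>The functions \<open>F\<^sub>c\<close>\<close>

abbreviation F_denom :: "real \<Rightarrow> complex \<Rightarrow> complex" where
  "F_denom c z \<equiv> 1 + of_real c * z + z\<^sup>2"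

text \<open>For |c| <= 2 no root lies in the disk: a nonreal root has c = -2 Re z and hence |z| = 1,
  while for real x in the disk 1 + cx + x^2 >= (1 - |x|)^2 > 0.\<close>

lemma F_denom_nonzero:
  assumes "c \<in> {-2..2}" "z \<in> ball 0 1"
  shows "F_denom c z \<noteq> 0"
proof
  assume 0: "F_denom c z = 0"
  have z: "(Re z)\<^sup>2 + (Im z)\<^sup>2 < 1"
    using assms(2) by (simp add: cmod_def)
  have re: "1 + c * Re z + (Re z)\<^sup>2 - (Im z)\<^sup>2 = 0" and im: "Im z * (c + 2 * Re z) = 0"
    using 0 by (auto simp: complex_eq_iff power2_eq_square algebra_simps)
  show False
  proof (cases "Im z = 0")
    case False
    then have "c = - 2 * Re z" using im by simp
    then show False using re z by (simp add: power2_eq_square)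
  next
    case True
    have "\<bar>c * Re z\<bar> \<le> 2 * \<bar>Re z\<bar>"
      using assms(1) by (auto simp: abs_mult intro!: mult_right_mono)
    moreover have "(1 - \<bar>Re z\<bar>)\<^sup>2 > 0"
      using z True by (auto simp: abs_square_less_1)
    ultimately show False
      using re True by (simp add: power2_eq_square algebra_simps)
  qed
qed

lemma has_field_derivative_F_c:
  assumes "F_denom c z \<noteq> 0"
  shows "(F_c c has_field_derivative (1 - z\<^sup>2) / (F_denom c z)\<^sup>2) (at z)"
  unfolding F_c_def
  by (rule derivative_eq_intros refl assms)+ (simp add: field_simps power2_eq_square assms)

lemma has_field_derivative_divide_F_denom:
  assumes "F_denom c z \<noteq> 0"
  shows "((\<lambda>z. 1 / F_denom c z) has_field_derivative - (of_real c + 2 * z) / (F_denom c z)\<^sup>2) (at z)"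
  by (rule derivative_eq_intros refl assms)+ (simp add: power2_eq_square)

lemma holomorphic_on_F_c:
  assumes "c \<in> {-2..2}"
  shows "F_c c holomorphic_on ball 0 1"
  using has_field_derivative_F_c[OF F_denom_nonzero[OF assms]]
  by (meson field_differentiable_at_within field_differentiable_def holomorphic_on_def)

text \<open>Equality of the values amounts to (z - w)(1 - zw) = 0, and |zw| < 1 rules out the second
  factor.\<close>

lemma inj_on_F_c:
  assumes "c \<in> {-2..2}"
  shows "inj_on (F_c c) (ball 0 1)"
proof (rule inj_onI)
  fix z w :: complex
  assume z: "z \<in> ball 0 1" and w: "w \<in> ball 0 1" and eq: "F_c c z = F_c c w"
  have "z * F_denom c w = w * F_denom c z"
    using eq F_denom_nonzero[OF assms z] F_denom_nonzero[OF assms w]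
    by (simp add: F_c_def frac_eq_eq)
  then have "(z - w) * (1 - z * w) = 0"
    by (simp add: algebra_simps power2_eq_square)
  moreover have "norm (z * w) < 1 * 1"
    unfolding norm_mult using z w by (intro mult_strict_mono') auto
  then have "z * w \<noteq> 1" by auto
  ultimately show "z = w" by simp
qed

text \<open>Since \<open>1 / F\<^sub>c z = z + 1 / z + c\<close>, solving \<open>F\<^sub>c z = w\<close> is a quadratic equation whose
  roots have product \<open>1\<close>, and they lie on the unit circle only if \<open>1 / w\<close> is real.\<close>

lemma F_c_image_nonreal:
  assumes "Im w \<noteq> 0"
  shows "w \<in> F_c c ` ball 0 1"
proof -
  define s where "s = 1 / w - of_real c"
  have w: "w \<noteq> 0" using assms by auto
  have s: "Im s \<noteq> 0" using assms by (simp add: s_def Im_divide cmod_power2)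
  define p where "p = (s + csqrt (s\<^sup>2 - 4)) / 2"
  define q where "q = (s - csqrt (s\<^sup>2 - 4)) / 2"
  have pq: "p * q = 1" "p + q = s"
  proof -
    have "p * q = (s\<^sup>2 - (csqrt (s\<^sup>2 - 4))\<^sup>2) / 4"
      by (simp add: p_def q_def power2_eq_square algebra_simps)
    then show "p * q = 1" by simp
  qed (simp add: p_def q_def field_simps)
  have "norm p \<noteq> 1"
  proof
    assume "norm p = 1"
    then have "p * cnj p = 1" by (simp add: complex_norm_square[symmetric])
    with pq(1) have "q = cnj p"
      by (metis mult_cancel_left mult_zero_left zero_neq_one)
    with pq(2) s show False by auto
  qed
  moreover have "norm p * norm q = 1"
    using pq(1) by (metis norm_mult norm_one)
  ultimately have "norm p < 1 \<or> norm q < 1"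
    by (metis linorder_neqE_linordered_idom mult_less_cancel_left_pos mult.right_neutral
        zero_less_one order_less_trans)
  \<comment> \<open>\<open>z\<close> is whichever of the two roots has modulus below 1, and
    \<open>s - z\<close> is the other.\<close>
  then obtain z where z: "norm z < 1" "z * (s - z) = 1"
    using pq by (auto simp: algebra_simps)
  then have "F_denom c z = z / w"
    using w by (simp add: s_def field_simps power2_eq_square)
  moreover have "z \<noteq> 0" using z by auto
  ultimately have "F_c c z = w" using w by (simp add: F_c_def)
  then show ?thesis using z by force
qed

text \<open>\<open>F_c c\<close> commutes with conjugation because its coefficients are real, so
  injectivity makes a point with real value its own conjugate.\<close>

lemma F_c_real_imp_real:
  assumes z: "z \<in> ball 0 1" and c: "c \<in> {-2..2}" and im: "Im (F_c c z) = 0"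
  shows "Im z = 0"
proof -
  obtain r where r: "F_c c z = of_real r"
    using im by (metis complex_is_Real_iff Reals_cases)
  have "cnj (F_c c z) = F_c c (cnj z)"
    by (simp add: F_c_def)
  then have "F_c c (cnj z) = F_c c z"
    using r by simp
  then have "cnj z = z"
    using inj_onD[OF inj_on_F_c[OF c]] z by simp
  then show ?thesis
    by (metis complex_is_Real_iff Reals_cnj_iff)
qed

text \<open>At height y other than 0 the section is the whole line; on the real axis it is the
  continuous image of (-1, 1).\<close>

lemma connected_F_c_horizontal_section:
  assumes c: "c \<in> {-2..2}"
  shows "connected (F_c c ` ball 0 1 \<inter> {w. Im w = y})"
proof (cases "y = 0")
  case False
  then have "F_c c ` ball 0 1 \<inter> {w. Im w = y} = {w. \<i> \<bullet> w = y}"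
    using F_c_image_nonreal by (auto simp: inner_complex_def)
  then show ?thesis
    by (simp only: convex_connected convex_hyperplane)
next
  case True
  have "F_c c ` ball 0 1 \<inter> {w. Im w = y} = (F_c c \<circ> of_real) ` {-1<..<1::real}" (is "?L = ?R")
  proof (intro equalityI subsetI)
    fix w assume "w \<in> ?L"
    then obtain z where z: "z \<in> ball 0 1" "w = F_c c z" "Im w = 0" using True by auto
    then have "z = of_real (Re z)"
      using F_c_real_imp_real[OF z(1) c] by (simp add: complex_eq_iff)
    moreover have "Re z \<in> {-1<..<1}"
      using z(1) abs_Re_le_cmod[of z] by auto
    ultimately show "w \<in> ?R"
      using z(2) by (metis comp_apply imageI)
  next
    fix w assume "w \<in> ?R"
    then obtain x where x: "x \<in> {-1<..<1}" "w = F_c c (of_real x)" by auto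
    then have "w = of_real (x / (1 + c * x + x\<^sup>2))"
      by (simp add: F_c_def)
    then have "Im w = y" using True by (simp only: Im_complex_of_real)
    moreover have "complex_of_real x \<in> ball 0 1" using x(1) by auto
    ultimately show "w \<in> ?L" using x(2) by blast
  qed
  moreover have "continuous_on {-1<..<1} (F_c c \<circ> of_real)"
    by (intro continuous_on_compose continuous_intros
        continuous_on_subset[OF holomorphic_on_imp_continuous_on[OF holomorphic_on_F_c[OF c]]]) auto
  ultimately show ?thesis
    by (simp only: connected_continuous_image[OF _ connected_Ioo])
qed

lemma F_c_image_horizontally_convex:
  assumes c: "c \<in> {-2..2}" and "Complex a y \<in> F_c c ` ball 0 1" "Complex b y \<in> F_c c ` ball 0 1"
    and "a \<le> x" "x \<le> b"
  shows "Complex x y \<in> F_c c ` ball 0 1"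
proof -
  let ?S = "F_c c ` ball 0 1 \<inter> {w. Im w = y}"
  have "connected (Re ` ?S)"
    by (intro connected_continuous_image connected_F_c_horizontal_section c continuous_intros)
  moreover have "a \<in> Re ` ?S" "b \<in> Re ` ?S"
    using assms(2,3) by (metis (mono_tags, lifting) IntI complex.sel imageI mem_Collect_eq)+
  ultimately have "x \<in> Re ` ?S"
    using assms(4,5) by (rule connectedD_interval)
  then show ?thesis by auto
qed

section \<open>The shear of \<open>F\<^sub>c\<close>\<close>

locale F_c_shear =
  fixes c :: real and h g :: "complex \<Rightarrow> complex"
  assumes c: "c \<in> {-2..2}" and shear: "horizontal_shear (F_c c) (\<lambda>z. z\<^sup>2) h g"
begin

abbreviation "f \<equiv> harmonic_map h g"

lemma denom [simp]: "z \<in> ball 0 1 \<Longrightarrow> F_denom c z \<noteq> 0"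
  by (rule F_denom_nonzero[OF c])

lemma hol: "h holomorphic_on ball 0 1" "g holomorphic_on ball 0 1"
  and diff: "z \<in> ball 0 1 \<Longrightarrow> h z - g z = F_c c z"
  and zero: "h 0 = 0" "g 0 = 0"
  using shear by (auto simp: horizontal_shear_def)

text \<open>Differentiating h - g = F_c gives (1 - z^2) h' = F_c', and 1 - z^2 has no zero in the
  disk.\<close>

lemma deriv_h_g:
  assumes z: "z \<in> ball 0 1"
  shows "deriv h z = 1 / (F_denom c z)\<^sup>2" "deriv g z = z\<^sup>2 / (F_denom c z)\<^sup>2"
proof -
  have g: "deriv g z = z\<^sup>2 * deriv h z"
    using shear z by (auto simp: horizontal_shear_def)
  have "((\<lambda>z. h z - g z) has_field_derivative deriv h z - deriv g z) (at z)"
    by (intro derivative_intros holomorphic_derivI[OF _ open_ball z] hol)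
  then have "(F_c c has_field_derivative deriv h z - deriv g z) (at z)"
    by (rule has_field_derivative_transform_within_open[OF _ open_ball z diff])
  then have "deriv h z - deriv g z = (1 - z\<^sup>2) / (F_denom c z)\<^sup>2"
    using has_field_derivative_F_c[OF denom[OF z]] DERIV_unique by blast
  then have "(1 - z\<^sup>2) * deriv h z = (1 - z\<^sup>2) * (1 / (F_denom c z)\<^sup>2)"
    by (simp add: g algebra_simps)
  moreover have "norm (z\<^sup>2) < 1"
    using z by (simp add: norm_power power_less_one_iff)
  then have "1 - z\<^sup>2 \<noteq> 0" by auto
  ultimately show *: "deriv h z = 1 / (F_denom c z)\<^sup>2"
    unfolding mult_cancel_left by blast
  show "deriv g z = z\<^sup>2 / (F_denom c z)\<^sup>2"
    by (simp add: g *)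
qed

lemma has_field_derivative_h_g:
  assumes z: "z \<in> ball 0 1"
  shows "(h has_field_derivative 1 / (F_denom c z)\<^sup>2) (at z)"
        "(g has_field_derivative z\<^sup>2 / (F_denom c z)\<^sup>2) (at z)"
  using holomorphic_derivI[OF hol(1) open_ball z] holomorphic_derivI[OF hol(2) open_ball z]
  by (simp_all only: deriv_h_g[OF z])

text \<open>Conjugating g flips the sign of Im g, so the shear moves points only horizontally: Im f
  = Im (h - g) = Im F_c.\<close>

lemma f_eq:
  assumes "z \<in> ball 0 1"
  shows "f z = Complex (Re (h z + g z)) (Im (F_c c z))"
  by (simp add: harmonic_map_def complex_eq_iff flip: diff[OF assms])

text \<open>Along a horizontal line, \<open>d/du Re (h + g) = Re ((h' + g') / F\<^sub>c') = Re ((1 + z\<^sup>2) / (1 - z\<^sup>2))\<close>,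
  the real part of the Cayley transform of \<open>- z\<^sup>2\<close>.\<close>

lemma Re_sum_less:
  assumes z: "z \<in> ball 0 1" and w: "w \<in> ball 0 1"
    and Im: "Im (F_c c z) = Im (F_c c w)" and Re: "Re (F_c c z) < Re (F_c c w)"
  shows "Re (h z + g z) < Re (h w + g w)"
proof -
  let ?B = "ball 0 1 :: complex set"
  define y where "y = Im (F_c c z)"
  note hF = holomorphic_on_F_c[OF c]
  obtain k where k: "k holomorphic_on F_c c ` ?B"
    "\<And>z. z \<in> ?B \<Longrightarrow> deriv (F_c c) z * deriv k (F_c c z) = 1" "\<And>z. z \<in> ?B \<Longrightarrow> k (F_c c z) = z"
    using holomorphic_has_inverse[OF hF open_ball inj_on_F_c[OF c]] by blast
  have op: "open (F_c c ` ?B)"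
    by (rule open_mapping_thm3[OF hF open_ball inj_on_F_c[OF c]])
  \<comment> \<open>\<open>\<psi>\<close> is Re (h + g) carried over to the line at height
    \<open>y\<close> by the inverse \<open>k\<close> of \<open>F_c c\<close>. Horizontal convexity
    of the image keeps the whole segment inside the domain of \<open>k\<close>.\<close>
  define \<psi> where "\<psi> x = Re (h (k (Complex x y)) + g (k (Complex x y)))" for x
  have "\<psi> (Re (F_c c z)) < \<psi> (Re (F_c c w))"
  proof (rule DERIV_pos_imp_increasing[OF Re])
    fix x assume x: "Re (F_c c z) \<le> x" "x \<le> Re (F_c c w)"
    have "Complex x y \<in> F_c c ` ?B"
    proof (rule F_c_image_horizontally_convex[OF c _ _ x])
      show "Complex (Re (F_c c z)) y \<in> F_c c ` ?B" "Complex (Re (F_c c w)) y \<in> F_c c ` ?B"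
        using z w by (simp_all add: y_def) (simp add: Im)
    qed
    then obtain v where v: "v \<in> ?B" "F_c c v = Complex x y" by auto
    define D where "D = (1 + v\<^sup>2) / (F_denom c v)\<^sup>2 * deriv k (F_c c v)"
    have kv: "k (F_c c v) = v" by (rule k(3)[OF v(1)])
    have hg: "((\<lambda>z. h z + g z) has_field_derivative (1 + v\<^sup>2) / (F_denom c v)\<^sup>2) (at (k (F_c c v)))"
      unfolding kv by (rule derivative_eq_intros has_field_derivative_h_g v refl)+
        (simp add: add_divide_distrib)
    have "(k has_field_derivative deriv k (F_c c v)) (at (F_c c v))"
      using holomorphic_derivI[OF k(1) op] v(1) by blast
    from DERIV_chain2[OF hg this]
    have "((\<lambda>u. h (k u) + g (k u)) has_field_derivative D) (at (Complex x y))"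
      by (simp only: D_def v(2))
    moreover have "((\<lambda>x. Complex x y) has_vector_derivative 1) (at x)"
      unfolding Complex_eq by (auto intro!: derivative_eq_intros)
    ultimately have "((\<lambda>x. h (k (Complex x y)) + g (k (Complex x y))) has_vector_derivative D) (at x)"
      using field_vector_diff_chain_at[of "\<lambda>x. Complex x y" 1 x "\<lambda>u. h (k u) + g (k u)" D]
      by (simp add: o_def)
    then have "(\<psi> has_real_derivative Re D) (at x)"
      unfolding \<psi>_def has_real_derivative_iff_has_vector_derivative
      by (rule bounded_linear.has_vector_derivative[OF bounded_linear_Re])
    moreover have "Re D > 0"
    proof -
      have "deriv (F_c c) v = (1 - v\<^sup>2) / (F_denom c v)\<^sup>2"
        by (rule DERIV_imp_deriv[OF has_field_derivative_F_c[OF denom[OF v(1)]]])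
      moreover have nv: "norm (- v\<^sup>2) < 1"
        using v(1) by (simp add: norm_power power_less_one_iff)
      then have "1 - v\<^sup>2 \<noteq> 0" by auto
      ultimately have "deriv k (F_c c v) = (F_denom c v)\<^sup>2 / (1 - v\<^sup>2)"
        using k(2)[OF v(1)] denom[OF v(1)] by (simp add: field_simps)
      then have "D = cayley (- v\<^sup>2)"
        using denom[OF v(1)] by (simp add: D_def cayley_def)
      moreover have "- v\<^sup>2 \<in> ball 0 1" using nv by simp
      ultimately show ?thesis
        using cayley_image_ball by blast
    qed
    ultimately show "\<exists>d. (\<psi> has_real_derivative d) (at x) \<and> d > 0" by blast
  qed
  moreover have "Complex (Re (F_c c z)) y = F_c c z" "Complex (Re (F_c c w)) y = F_c c w"
    by (simp add: y_def, simp add: y_def Im)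
  ultimately show ?thesis
    using k(3) z w by (simp add: \<psi>_def)
qed

section \<open>Univalence and horizontal convexity of the sheared map\<close>

lemma inj_on_f: "inj_on f (ball 0 1)"
proof (rule inj_onI)
  fix z w assume z: "z \<in> ball 0 1" and w: "w \<in> ball 0 1" and "f z = f w"
  then have Re: "Re (h z + g z) = Re (h w + g w)" and Im: "Im (F_c c z) = Im (F_c c w)"
    by (simp_all only: f_eq complex.inject)
  \<comment> \<open>The two values of \<open>F_c c\<close> lie at the same height; were their real
    parts different, strict monotonicity would separate Re (h + g).\<close>
  have "Re (F_c c z) = Re (F_c c w)"
    using Re_sum_less[OF z w Im] Re_sum_less[OF w z Im[symmetric]] Re
    by (metis linorder_neqE_linordered_idom order_less_irrefl)
  with Im have "F_c c z = F_c c w" by (simp add: complex_eq_iff)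
  then show "z = w" using inj_onD[OF inj_on_F_c[OF c]] z w by blast
qed

lemma continuous_on_f: "continuous_on (ball 0 1) f"
  unfolding harmonic_map_def
  by (intro continuous_intros holomorphic_on_imp_continuous_on hol)

lemma f_in_S_H_0: "f \<in> S_H_0"
  using inj_on_f shear by (auto simp: S_H_0_def horizontal_shear_def harmonic_map_def)

text \<open>The map is only harmonic, so invariance of domain replaces the open mapping
  theorem.\<close>

lemma open_f_image: "open (f ` ball 0 1)"
  by (rule invariance_of_domain[OF continuous_on_f open_ball inj_on_f])

lemma convex_in_horizontal_direction_f: "convex_in_horizontal_direction (f ` ball 0 1)"
  unfolding convex_in_horizontal_direction_def
proof (intro conjI allI open_f_image)
  show "connected (f ` ball 0 1)"
    by (intro connected_continuous_image continuous_on_f) simp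
next
  fix y
  note hF = holomorphic_on_F_c[OF c]
  obtain k where k: "k holomorphic_on F_c c ` ball 0 1" "\<And>z. z \<in> ball 0 1 \<Longrightarrow> k (F_c c z) = z"
  proof (rule holomorphic_has_inverse[OF hF open_ball inj_on_F_c[OF c]])
    fix k
    assume "k holomorphic_on F_c c ` ball 0 1" "\<And>z. z \<in> ball 0 1 \<Longrightarrow> k (F_c c z) = z"
    then show thesis by (rule that)
  qed
  let ?S = "F_c c ` ball 0 1 \<inter> {w. Im w = y}"
  \<comment> \<open>As f preserves the height of F_c, its section is the image of the connected
    section of F_c under f composed with the inverse of F_c.\<close>
  have "f ` ball 0 1 \<inter> {w. Im w = y} = (f \<circ> k) ` ?S" (is "?L = ?R")
  proof (intro equalityI subsetI)
    fix w assume "w \<in> ?L"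
    then obtain z where z: "z \<in> ball 0 1" "w = f z" "Im (f z) = y" by auto
    then have "F_c c z \<in> ?S" by (auto simp: f_eq)
    moreover have "w = (f \<circ> k) (F_c c z)" by (simp add: z(2) k(2)[OF z(1)])
    ultimately show "w \<in> ?R" by (rule rev_image_eqI)
  next
    fix w assume "w \<in> ?R"
    then obtain z where z: "z \<in> ball 0 1" "Im (F_c c z) = y" "w = f (k (F_c c z))" by auto
    then have "w = f z" by (simp only: k(2))
    moreover have "Im (f z) = y"
      by (simp only: f_eq[OF z(1)] complex.sel z(2))
    ultimately show "w \<in> ?L" using z(1) by blast
  qed
  moreover have "continuous_on ?S (f \<circ> k)"
  proof (rule continuous_on_compose)
    show "continuous_on ?S k"
      by (rule continuous_on_subset[OF holomorphic_on_imp_continuous_on[OF k(1)]]) auto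
    show "continuous_on (k ` ?S) f"
      by (rule continuous_on_subset[OF continuous_on_f]) (auto simp: k)
  qed
  ultimately show "connected (f ` ball 0 1 \<inter> {w. Im w = y})"
    by (simp only: connected_continuous_image[OF _ connected_F_c_horizontal_section[OF c]])
qed

section \<open>The lift\<close>

lemma lift_eq:
  assumes z: "z \<in> ball 0 1"
  shows "lift h g z = vector [Re (h z + g z), Im (F_c c z), Im (1 - 1 / F_denom c z - of_real c * h z)]"
proof -
  \<comment> \<open>Writing D for the denominator, (1/D)' = -(c + 2z)/D^2 and h' = 1/D^2, so P' =
    z/D^2 = z h'. The constant 1 makes \<open>P 0 = 0\<close>.\<close>
  define P where "P z = (1 - 1 / F_denom c z - of_real c * h z) / 2" for z
  have P: "(P has_field_derivative z * deriv h z) (at z within ball 0 1)" if "z \<in> ball 0 1" for z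
    unfolding P_def deriv_h_g[OF that]
    by (rule has_field_derivative_at_within)
      (rule has_field_derivative_divide_F_denom derivative_eq_intros has_field_derivative_h_g that denom refl |
       simp add: add_divide_distrib diff_divide_distrib algebra_simps)+
  have "path_image (linepath 0 z) \<subseteq> ball 0 1"
    using z by (simp add: closed_segment_subset)
  then have "((\<lambda>z. z * deriv h z) has_contour_integral P z - P 0) (linepath 0 z)"
    using contour_integral_primitive[OF P, of "linepath 0 z"] by simp
  moreover have "P 0 = 0" by (simp add: P_def zero)
  ultimately have "contour_integral (linepath 0 z) (\<lambda>\<zeta>. \<zeta> * deriv h \<zeta>) = P z"
    by (simp add: contour_integral_unique)
  moreover have "2 * Im (P z) = Im (1 - 1 / F_denom c z - of_real c * h z)"
    by (simp add: P_def)
  ultimately show ?thesis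
    by (simp only: lift_def diff[OF z])
qed

text \<open>The holomorphic curve whose real part is the lift; the factor -i turns imaginary parts
  into real parts.\<close>

definition weierstrass :: "3 \<Rightarrow> complex \<Rightarrow> complex" where
  "weierstrass i z = (if i = 1 then h z + g z else if i = 2 then - \<i> * F_c c z
     else - \<i> * (1 - 1 / F_denom c z - of_real c * h z))"

lemma weierstrass_simps:
  "weierstrass 1 = (\<lambda>z. h z + g z)" "weierstrass 2 = (\<lambda>z. - \<i> * F_c c z)"
  "weierstrass 3 = (\<lambda>z. - \<i> * (1 - 1 / F_denom c z - of_real c * h z))"
  by (simp_all add: weierstrass_def fun_eq_iff)

lemma deriv_weierstrass:
  assumes z: "z \<in> ball 0 1"
  shows "(weierstrass 1 has_field_derivative (1 + z\<^sup>2) / (F_denom c z)\<^sup>2) (at z)"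
    and "(weierstrass 2 has_field_derivative - \<i> * (1 - z\<^sup>2) / (F_denom c z)\<^sup>2) (at z)"
    and "(weierstrass 3 has_field_derivative - 2 * \<i> * z / (F_denom c z)\<^sup>2) (at z)"
  unfolding weierstrass_simps
  by (rule has_field_derivative_divide_F_denom derivative_eq_intros has_field_derivative_h_g
        has_field_derivative_F_c denom z refl |
       simp add: add_divide_distrib diff_divide_distrib algebra_simps)+

lemma holomorphic_weierstrass: "weierstrass i holomorphic_on ball 0 1"
proof -
  have "weierstrass i field_differentiable at z" if "z \<in> ball 0 1" for z
    using exhaust_3[of i] deriv_weierstrass[OF that] by (auto simp: field_differentiable_def)
  then show ?thesis
    by (meson field_differentiable_at_within holomorphic_on_def)
qed

lemma lift_eq_weierstrass:
  assumes "z \<in> ball 0 1"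
  shows "lift h g z = (\<chi> i. Re (weierstrass i z))"
  unfolding lift_eq[OF assms] by (simp add: vec_eq_iff forall_3 weierstrass_simps)

lemma weierstrass_null:
  assumes "z \<in> ball 0 1"
  shows "(\<Sum>i\<in>UNIV. (deriv (weierstrass i) z)\<^sup>2) = 0"
proof -
  define e where "e = (F_denom c z)\<^sup>2"
  \<comment> \<open>After the common factor 1/D^2 is removed, nullity is (1 + z^2)^2 = (1 - z^2)^2 +
    4z^2.\<close>
  have "(1 + z\<^sup>2)\<^sup>2 + (- \<i> * (1 - z\<^sup>2))\<^sup>2 + (- 2 * \<i> * z)\<^sup>2 = 0"
    by (simp add: power2_eq_square algebra_simps)
  then show ?thesis
    unfolding sum_3 deriv_weierstrass[OF assms, THEN DERIV_imp_deriv] e_def[symmetric] power_divide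
      add_divide_distrib[symmetric] by simp
qed

lemma weierstrass_regular:
  assumes "z \<in> ball 0 1"
  shows "deriv (weierstrass 2) z \<noteq> 0"
proof -
  have "norm (z\<^sup>2) < 1"
    using assms by (simp add: norm_power power_less_one_iff)
  then have "1 - z\<^sup>2 \<noteq> 0" by auto
  then show ?thesis
    using DERIV_imp_deriv[OF deriv_weierstrass(2)[OF assms]] denom[OF assms] by simp
qed

text \<open>Vertical projection of the lift is f itself; this makes the lift a graph and supplies
  its continuous inverse.\<close>

lemma lift_over_f:
  assumes "z \<in> ball 0 1"
  shows "Complex (lift h g z $ 1) (lift h g z $ 2) = f z"
  by (simp add: lift_eq[OF assms] f_eq[OF assms])

lemma local_parametrization_lift: "local_parametrization (lift h g) (ball 0 1) (lift h g ` ball 0 1)"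
  unfolding local_parametrization_def
proof (intro conjI ballI open_ball openin_subtopology_self)
  show smooth: "smooth_on (lift h g) (ball 0 1)"
    by (rule smooth_on_Re_holomorphic[OF open_ball holomorphic_weierstrass lift_eq_weierstrass])
  show "cross3 (pd_u (lift h g) z) (pd_v (lift h g) z) \<noteq> 0" if "z \<in> ball 0 1" for z
    by (rule null_curve_regular[OF open_ball holomorphic_weierstrass lift_eq_weierstrass
          weierstrass_null that weierstrass_regular[OF that]])
  obtain k where k: "homeomorphism (ball 0 1) (f ` ball 0 1) f k"
    using invariance_of_domain_homeomorphism[OF open_ball continuous_on_f order_refl inj_on_f] .
  \<comment> \<open>The inverse of the lift is vertical projection followed by the inverse of
    f.\<close>
  define Y where "Y p = k (Complex (p $ 1) (p $ 2))" for p :: "real^3"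
  have "homeomorphism (ball 0 1) (lift h g ` ball 0 1) (lift h g) Y"
  proof (rule homeomorphismI)
    have "Ck_on 0 (lift h g) (ball 0 1)" using smooth by (simp only: smooth_on_def)
    then show "continuous_on (ball 0 1) (lift h g)" by simp
    have "(\<lambda>p. Complex (p $ 1) (p $ 2)) ` lift h g ` ball 0 1 \<subseteq> f ` ball 0 1"
      using lift_over_f by fastforce
    then show "continuous_on (lift h g ` ball 0 1) Y"
      unfolding Y_def Complex_eq
      by (intro continuous_on_compose2[OF homeomorphism_cont2[OF k]] continuous_intros)
  qed (use homeomorphism_apply1[OF k] lift_over_f in \<open>auto simp: Y_def\<close>)
  then show "\<exists>Y. homeomorphism (ball 0 1) (lift h g ` ball 0 1) (lift h g) Y" by blast
qed

lemma minimal_graph_lift: "minimal_graph (f ` ball 0 1) (lift h g ` ball 0 1)"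
  unfolding minimal_graph_def
proof (intro conjI open_f_image)
  show "connected (f ` ball 0 1)"
    using convex_in_horizontal_direction_f by (simp add: convex_in_horizontal_direction_def)
  show "minimal_surface (lift h g ` ball 0 1)"
    unfolding minimal_surface_def
  proof (intro ballI exI conjI)
    show "local_parametrization (lift h g) (ball 0 1) (lift h g ` ball 0 1)"
      by (rule local_parametrization_lift)
    show "mean_curvature (lift h g) z = 0" if "z \<in> ball 0 1" for z
      by (rule null_curve_mean_curvature[OF open_ball holomorphic_weierstrass lift_eq_weierstrass
            weierstrass_null that])
  qed
  let ?k = "inv_into (ball 0 1) f"
  have "lift h g z = vector [Re (f z), Im (f z), lift h g (?k (f z)) $ 3]" if "z \<in> ball 0 1" for z
    using arg_cong[OF lift_over_f[OF that], of Re] arg_cong[OF lift_over_f[OF that], of Im]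
    by (simp add: inv_into_f_f[OF inj_on_f that] vec_eq_iff forall_3)
  then have "lift h g ` ball 0 1 = (\<lambda>w. vector [Re w, Im w, lift h g (?k w) $ 3]) ` f ` ball 0 1"
    by (auto simp: image_image intro!: image_cong)
  then show "\<exists>G. lift h g ` ball 0 1 = (\<lambda>w. vector [Re w, Im w, G w]) ` f ` ball 0 1"
    by (rule exI[where x = "\<lambda>w. lift h g (?k w) $ 3"])
qed simp

lemma parametrizes_lift: "parametrizes (lift h g) (ball 0 1) (lift h g ` ball 0 1)"
  by (simp add: parametrizes_def local_parametrization_lift)

section \<open>The symmetry between c and -c, from F_(-c)(z) = -F_c(-z)\<close>

lemma reflected: "F_c_shear (- c) (\<lambda>z. - h (- z)) (\<lambda>z. - g (- z))"
proof
  show "- c \<in> {-2..2}" using c by auto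
  have d: "((\<lambda>z. - k (- z)) has_field_derivative d (- z)) (at z)"
    if "\<And>z. z \<in> ball 0 1 \<Longrightarrow> (k has_field_derivative d z) (at z)" "z \<in> ball 0 1"
    for k d :: "complex \<Rightarrow> complex" and z
  proof -
    have "((\<lambda>z. k (- z)) has_field_derivative d (- z) * - 1) (at z)"
      by (rule DERIV_chain2[OF that(1)]) (use that(2) in \<open>auto intro!: derivative_eq_intros\<close>)
    from DERIV_minus[OF this] show ?thesis by simp
  qed
  note dh = d[OF has_field_derivative_h_g(1)] and dg = d[OF has_field_derivative_h_g(2)]
  have "(\<lambda>z. - h (- z)) holomorphic_on ball 0 1" "(\<lambda>z. - g (- z)) holomorphic_on ball 0 1"
    using dh dg by (simp_all only: holomorphic_on_open[OF open_ball]) blast+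
  moreover have "- h (- z) - - g (- z) = F_c (- c) z" if "z \<in> ball 0 1" for z
  proof -
    have "- h (- z) - - g (- z) = - F_c c (- z)"
      using that by (simp flip: diff)
    also have "\<dots> = F_c (- c) z"
      by (simp add: F_c_def)
    finally show ?thesis .
  qed
  ultimately show "horizontal_shear (F_c (- c)) (\<lambda>z. z\<^sup>2) (\<lambda>z. - h (- z)) (\<lambda>z. - g (- z))"
    using dh[THEN DERIV_imp_deriv] dg[THEN DERIV_imp_deriv]
    by (simp add: horizontal_shear_def zero)
qed

lemma harmonic_map_reflected:
  "harmonic_map (\<lambda>z. - h (- z)) (\<lambda>z. - g (- z)) z = - f (- z)"
  by (simp add: harmonic_map_def)

text \<open>In \<open>lift_eq\<close> both the denominator and the product c h(z) are unchanged when
  c, h, z become -c, -h(-z), -z in step, so only the first two coordinates change sign.\<close>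

lemma lift_reflected:
  assumes "z \<in> ball 0 1"
  shows "lift (\<lambda>z. - h (- z)) (\<lambda>z. - g (- z)) z =
    vector [- lift h g (- z) $ 1, - lift h g (- z) $ 2, lift h g (- z) $ 3]"
proof -
  have "- z \<in> ball 0 1" using assms by simp
  then show ?thesis
    by (simp add: F_c_shear.lift_eq[OF reflected assms] lift_eq F_c_def)
qed

end

section \<open>Existence of the shear\<close>

lemma ex_horizontal_shear_F_c:
  assumes c: "c \<in> {-2..2}"
  shows "\<exists>h g. horizontal_shear (F_c c) (\<lambda>z. z\<^sup>2) h g"
proof -
  note [simp] = F_denom_nonzero[OF c]
  have "(\<lambda>z. 1 / (F_denom c z)\<^sup>2) holomorphic_on ball 0 1"
    by (intro holomorphic_intros) auto
  then obtain h where h: "\<And>z. z \<in> ball 0 1 \<Longrightarrow>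
      (h has_field_derivative 1 / (F_denom c z)\<^sup>2) (at z within ball 0 1)"
    using holomorphic_convex_primitive'[OF convex_ball open_ball] by blast
  define H where "H z = h z - h 0" for z
  \<comment> \<open>With H' = 1/D^2 and F_c' = (1 - z^2)/D^2, this choice yields G' = z^2/D^2 = z^2
    H'.\<close>
  define G where "G z = H z - F_c c z" for z
  have H: "(H has_field_derivative 1 / (F_denom c z)\<^sup>2) (at z)" if "z \<in> ball 0 1" for z
    unfolding H_def
    using h[OF that] that by (auto intro!: derivative_eq_intros simp: at_within_open[OF _ open_ball])
  have G: "(G has_field_derivative z\<^sup>2 / (F_denom c z)\<^sup>2) (at z)" if "z \<in> ball 0 1" for z
    unfolding G_def
    by (rule derivative_eq_intros H has_field_derivative_F_c F_denom_nonzero[OF c] that refl)+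
      (simp add: diff_divide_distrib)
  have "H holomorphic_on ball 0 1" "G holomorphic_on ball 0 1"
    using H G by (meson field_differentiable_at_within field_differentiable_def holomorphic_on_def)+
  then have "horizontal_shear (F_c c) (\<lambda>z. z\<^sup>2) H G"
    using H[THEN DERIV_imp_deriv] G[THEN DERIV_imp_deriv]
    by (simp add: horizontal_shear_def) (simp add: G_def H_def F_c_def)
  then show ?thesis by blast
qed

section \<open>The helicoid\<close>

lemma eq_on_unit_disc_if_deriv_eq:
  fixes u v :: "complex \<Rightarrow> complex"
  assumes "\<And>z. z \<in> ball 0 1 \<Longrightarrow> (u has_field_derivative d z) (at z)"
    and "\<And>z. z \<in> ball 0 1 \<Longrightarrow> (v has_field_derivative d z) (at z)"
    and "u 0 = v 0" "z \<in> ball 0 1"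
  shows "u z = v z"
proof -
  have "((\<lambda>z. u z - v z) has_field_derivative 0) (at z within ball 0 1)" if "z \<in> ball 0 1" for z
    using DERIV_diff[OF assms(1,2)[OF that]] by (simp add: has_field_derivative_at_within)
  from has_field_derivative_zero_constant[OF convex_ball this]
  obtain C where C: "\<forall>z\<in>ball 0 1. u z - v z = C" by (rule exE)
  have "u 0 - v 0 = C" by (rule bspec[OF C]) simp
  moreover have "u z - v z = C" by (rule bspec[OF C assms(4)])
  ultimately show ?thesis
    using assms(3) by simp
qed

lemma similarity_scaled: "k \<noteq> 0 \<Longrightarrow> orthogonal_transformation R \<Longrightarrow> similarity (\<lambda>x. a + k *\<^sub>R R x)"
  unfolding similarity_def by blast

text \<open>Precomposing the similarity with the involution R undoes its action on S.\<close>

lemma is_part_of_orthogonal_image: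
  assumes R: "orthogonal_transformation R" "\<And>x. R (R x) = x" and "is_part_of S M"
  shows "is_part_of (R ` S) M"
proof -
  obtain a k Q where *: "k \<noteq> 0" "orthogonal_transformation Q" "(\<lambda>x. a + k *\<^sub>R Q x) ` S \<subseteq> M"
    using assms(3) unfolding is_part_of_def similarity_def by blast
  have "similarity (\<lambda>x. a + k *\<^sub>R (Q \<circ> R) x)"
    by (rule similarity_scaled[OF *(1) orthogonal_transformation_compose[OF *(2) R(1)]])
  moreover have "(\<lambda>x. a + k *\<^sub>R (Q \<circ> R) x) ` R ` S \<subseteq> M"
    using *(3) by (auto simp: R(2))
  ultimately show ?thesis unfolding is_part_of_def by blast
qed

context
  fixes h g :: "complex \<Rightarrow> complex"
  assumes shear: "F_c_shear 0 h g"
begin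

interpretation F_c_shear 0 h g by (rule shear)

lemma lift_0_eq:
  assumes z: "z \<in> ball 0 1"
  defines "q \<equiv> cayley (- \<i> * z)"
  shows "lift h g z = vector [Im (Ln q) / 2, - Re (q - 1 / q) / 4, - Im (q + 1 / q) / 4]"
proof -
  have ne: "1 - \<i> * z \<noteq> 0" "1 + \<i> * z \<noteq> 0" and dn: "1 + z\<^sup>2 = (1 + \<i> * z) * (1 - \<i> * z)"
    if "z \<in> ball 0 1" for z
  proof -
    have "norm (\<i> * z) < 1" "norm (- (\<i> * z)) < 1" using that by (auto simp: norm_mult)
    then show "1 - \<i> * z \<noteq> 0" "1 + \<i> * z \<noteq> 0"
      by (auto simp: add_eq_0_iff dest!: sym[of 1])
  qed (simp add: algebra_simps power2_eq_square)
  have Req: "Re (cayley (- \<i> * z)) > 0" if "z \<in> ball 0 1" for z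
    using that cayley_rotated_image_ball by blast
  \<comment> \<open>For c = 0 the derivative of h + g is 1/(1 + z^2), so this is arctan z in
    logarithmic form.\<close>
  have W1: "weierstrass 1 z = - \<i> / 2 * Ln q"
    unfolding q_def
  proof (rule eq_on_unit_disc_if_deriv_eq[where u = "weierstrass 1", OF deriv_weierstrass(1) _ _ z])
    fix z :: complex assume z: "z \<in> ball 0 1"
    have "cayley (- \<i> * z) \<notin> \<real>\<^sub>\<le>\<^sub>0"
      using Req[OF z] by (auto simp: complex_nonpos_Reals_iff)
    moreover have "- \<i> * z \<noteq> -1" using ne(1)[OF z] by auto
    ultimately have "((\<lambda>z. - \<i> / 2 * Ln (cayley (- \<i> * z))) has_field_derivative
        - \<i> / 2 * (inverse (cayley (- \<i> * z)) * (- 2 / (1 + - \<i> * z)\<^sup>2 * - \<i>))) (at z)"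
      by (intro DERIV_cmult DERIV_chain2[OF has_field_derivative_Ln]
          DERIV_chain2[OF has_field_derivative_cayley] DERIV_cmult_Id)
    also have "- \<i> / 2 * (inverse (cayley (- \<i> * z)) * (- 2 / (1 + - \<i> * z)\<^sup>2 * - \<i>)) =
        1 / ((1 + \<i> * z) * (1 - \<i> * z))"
    proof -
      define u v where "u = 1 + \<i> * z" and "v = 1 - \<i> * z"
      have "cayley (- \<i> * z) = u / v" "1 + - \<i> * z = v"
        by (simp_all add: u_def v_def cayley_def)
      moreover have "u \<noteq> 0" "v \<noteq> 0" using ne[OF z] by (simp_all add: u_def v_def)
      ultimately show ?thesis
        unfolding u_def[symmetric] v_def[symmetric] by (simp add: power2_eq_square)
    qed
    also have "\<dots> = 1 / (1 + z\<^sup>2)"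
      by (simp only: dn[OF z])
    also have "\<dots> = (1 + z\<^sup>2) / (F_denom 0 z)\<^sup>2"
      using denom[OF z] by (simp add: power2_eq_square)
    finally show "((\<lambda>z. - \<i> / 2 * Ln (cayley (- \<i> * z))) has_field_derivative
        (1 + z\<^sup>2) / (F_denom 0 z)\<^sup>2) (at z)" .
  qed (simp_all add: weierstrass_simps zero cayley_def)
  have q: "q = (1 + \<i> * z) / (1 - \<i> * z)" by (simp add: q_def cayley_def)
  \<comment> \<open>Applied with u = 1 + iz and v = 1 - iz, where uv = 1 + z^2 and u - v =
    2iz.\<close>
  have frac: "u / v - 1 / (u / v) = (u\<^sup>2 - v\<^sup>2) / (u * v)"
    "1 - 1 / (u * v) = - (u / v + 1 / (u / v) - 2) / 4 \<longleftrightarrow> 4 * (1 - u * v) = (u - v)\<^sup>2"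
    if "u \<noteq> 0" "v \<noteq> 0" for u v :: complex
    using that by (simp_all add: divide_simps) (auto simp: power2_eq_square algebra_simps)
  have "q - 1 / q = ((1 + \<i> * z)\<^sup>2 - (1 - \<i> * z)\<^sup>2) / (1 + z\<^sup>2)"
    unfolding q dn[OF z] by (rule frac(1)[OF ne(2,1)[OF z]])
  also have "(1 + \<i> * z)\<^sup>2 - (1 - \<i> * z)\<^sup>2 = 4 * \<i> * z"
    by (simp add: power2_eq_square algebra_simps)
  finally have F: "F_c 0 z = - \<i> / 4 * (q - 1 / q)"
    by (simp add: F_c_def)
  have V: "1 - 1 / (1 + z\<^sup>2) = - (q + 1 / q - 2) / 4"
    unfolding q dn[OF z] frac(2)[OF ne(2,1)[OF z]] by (simp add: power2_eq_square algebra_simps)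
  have "weierstrass 3 z = - \<i> * (1 - 1 / (1 + z\<^sup>2))"
    by (simp add: weierstrass_simps)
  with W1 F show ?thesis
    unfolding V
    by (simp add: lift_eq_weierstrass[OF z] vec_eq_iff forall_3 weierstrass_simps(2) add_divide_distrib)
qed

text \<open>By \<open>lift_0_eq\<close> the coordinates are those of \<open>Y0 q\<close> up to
  order, signs and the factor 4, and Re q > 0 keeps q off the branch cut.\<close>

lemma lift_0_part_of_helicoid: "is_part_of (lift h g ` ball 0 1) helicoid"
proof -
  define R where "R x = (vector [- x $ 2, - x $ 3, x $ 1] :: real^3)" for x :: "real^3"
  have R: "orthogonal_transformation R"
    unfolding orthogonal_transformation_def
    by (auto intro!: linearI simp: R_def vec_eq_iff forall_3 inner_vec_def sum_3)
  have "0 + 4 *\<^sub>R R (lift h g z) \<in> helicoid" if z: "z \<in> ball 0 1" for z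
  proof -
    define q where "q = cayley (- \<i> * z)"
    have "Re q > 0" using z cayley_rotated_image_ball by (auto simp: q_def)
    then have "q \<in> - (complex_of_real ` {..0})" by auto
    moreover have "0 + 4 *\<^sub>R R (lift h g z) = Y0 q"
      unfolding lift_0_eq[OF z, folded q_def]
      by (simp add: R_def Y0_def vec_eq_iff forall_3 diff_divide_distrib)
    ultimately show ?thesis unfolding helicoid_def by blast
  qed
  then show ?thesis
    unfolding is_part_of_def using similarity_scaled[OF _ R, of 4 0] by (intro exI conjI) auto
qed

text \<open>For q = exp (t + i\<theta>) the value of f is \<theta>/2 - (i/2) sinh t cos \<theta>.
  Here |\<theta>| < pi/2 fixes the width of the strip, and for each \<theta> solving for t by arsinh
  reaches every height.\<close>

lemma f_0_image: "f ` ball 0 1 = {w. - pi / 4 < Re w \<and> Re w < pi / 4}"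
proof -
  define T where "T q = Complex (Im (Ln q) / 2) (- Re (q - 1 / q) / 4)" for q
  have "f z = T (cayley (- \<i> * z))" if "z \<in> ball 0 1" for z
    by (simp only: lift_over_f[OF that, symmetric] lift_0_eq[OF that] vector_3 T_def)
  then have "f ` ball 0 1 = T ` (\<lambda>z. cayley (- \<i> * z)) ` ball 0 1"
    unfolding image_image by (rule image_cong[OF refl])
  also have "\<dots> = T ` {q. Re q > 0}"
    by (simp only: cayley_rotated_image_ball)
  also have "\<dots> = {w. - pi / 4 < Re w \<and> Re w < pi / 4}"
  proof (intro equalityI subsetI)
    fix w assume "w \<in> T ` {q. Re q > 0}"
    then obtain q where q: "w = T q" "Re q > 0" by auto
    then have "\<bar>Im (Ln q)\<bar> < pi / 2"
      using Re_Ln_pos_lt_imp by blast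
    then show "w \<in> {w. - pi / 4 < Re w \<and> Re w < pi / 4}"
      by (auto simp: q(1) T_def)
  next
    fix w assume "w \<in> {w. - pi / 4 < Re w \<and> Re w < pi / 4}"
    then have w: "- (pi / 2) < 2 * Re w" "2 * Re w < pi / 2" by auto
    then have cos: "cos (2 * Re w) > 0" by (intro cos_gt_zero_pi) auto
    define t where "t = arsinh (- 2 * Im w / cos (2 * Re w))"
    define q where "q = exp (Complex t (2 * Re w))"
    have Req: "Re q > 0" using cos by (simp add: q_def Re_exp)
    have "Ln q = Complex t (2 * Re w)"
      unfolding q_def using w by (intro Ln_exp) auto
    moreover have "Re (q - 1 / q) = 2 * sinh t * cos (2 * Re w)"
    proof -
      have "1 / q = exp (- Complex t (2 * Re w))" by (simp add: q_def exp_minus field_simps)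
      then show ?thesis by (simp add: q_def Re_exp sinh_def algebra_simps)
    qed
    then have "Re (q - 1 / q) = - 4 * Im w"
      using cos by (simp add: t_def)
    ultimately have "w = T q" by (simp add: T_def complex_eq_iff)
    with Req show "w \<in> T ` {q. Re q > 0}" by blast
  qed
  finally show ?thesis .
qed

end

section \<open>Enneper's surface\<close>

context
  fixes h g :: "complex \<Rightarrow> complex"
  assumes shear: "F_c_shear 2 h g"
begin

interpretation F_c_shear 2 h g by (rule shear)

text \<open>Here D = (1 + z)^2 and dw = -2 dz/(1 + z)^2, so the first and third Weierstrass
  integrands become, up to constant factors, (1 + w^2) dw and (1 - w^2) dw. The constants 1/3 and
  1/6 make the primitives vanish at z = 0, where w = 1.\<close>

lemma lift_2_eq:
  assumes z: "z \<in> ball 0 1"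
  defines "w \<equiv> cayley z"
  shows "lift h g z = vector [1 / 3 - Re (w + w ^ 3 / 3) / 4, - Im (w\<^sup>2) / 4, - Im (w - w ^ 3 / 3) / 4]"
proof -
  have ne: "1 + z \<noteq> 0" and dn: "F_denom 2 z = (1 + z)\<^sup>2" if "z \<in> ball 0 1" for z
    using that by (auto simp: add_eq_0_iff power2_eq_square algebra_simps)
  have dc: "(cayley has_field_derivative - 2 / (1 + z)\<^sup>2) (at z)" if "z \<in> ball 0 1" for z
    using that by (intro has_field_derivative_cayley) auto
  have pm: "1 + (cayley z)\<^sup>2 = 2 * (1 + z\<^sup>2) / (1 + z)\<^sup>2" "1 - (cayley z)\<^sup>2 = 4 * z / (1 + z)\<^sup>2"
    if "z \<in> ball 0 1" for z
    using ne[OF that] by (simp_all add: cayley_def power_divide field_simps) (simp_all add: power2_eq_square algebra_simps)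
  have frac: "- ((2 * a / e) * (- 2 / e)) / 4 = a / e\<^sup>2" for a e :: complex
    by (simp add: power2_eq_square)
  have W1: "weierstrass 1 z = 1 / 3 - (w + w ^ 3 / 3) / 4"
    unfolding w_def
  proof (rule eq_on_unit_disc_if_deriv_eq[where u = "weierstrass 1", OF deriv_weierstrass(1) _ _ z])
    fix z :: complex assume z: "z \<in> ball 0 1"
    have "((\<lambda>z. 1 / 3 - (cayley z + cayley z ^ 3 / 3) / 4) has_field_derivative
        - ((1 + (cayley z)\<^sup>2) * (- 2 / (1 + z)\<^sup>2)) / 4) (at z)"
      by (rule DERIV_cdivide derivative_eq_intros dc z refl)+ (simp add: ne[OF z] field_simps)
    also have "- ((1 + (cayley z)\<^sup>2) * (- 2 / (1 + z)\<^sup>2)) / 4 = (1 + z\<^sup>2) / (F_denom 2 z)\<^sup>2"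
      unfolding pm[OF z] dn[OF z] by (rule frac)
    finally show "((\<lambda>z. 1 / 3 - (cayley z + cayley z ^ 3 / 3) / 4) has_field_derivative
        (1 + z\<^sup>2) / (F_denom 2 z)\<^sup>2) (at z)" .
  qed (simp_all add: weierstrass_simps zero cayley_def)
  have W3: "weierstrass 3 z = - \<i> * (1 / 6 - (w - w ^ 3 / 3) / 4)"
    unfolding w_def
  proof (rule eq_on_unit_disc_if_deriv_eq[where u = "weierstrass 3", OF deriv_weierstrass(3) _ _ z])
    fix z :: complex assume z: "z \<in> ball 0 1"
    have "((\<lambda>z. 1 / 6 - (cayley z - cayley z ^ 3 / 3) / 4) has_field_derivative
        - ((1 - (cayley z)\<^sup>2) * (- 2 / (1 + z)\<^sup>2)) / 4) (at z)"
      by (rule DERIV_cdivide derivative_eq_intros dc z refl)+ (simp add: ne[OF z] field_simps)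
    also have "- ((1 - (cayley z)\<^sup>2) * (- 2 / (1 + z)\<^sup>2)) / 4 = 2 * z / (F_denom 2 z)\<^sup>2"
      using frac[of "2 * z" "(1 + z)\<^sup>2"] unfolding pm[OF z] dn[OF z] by simp
    finally show "((\<lambda>z. - \<i> * (1 / 6 - (cayley z - cayley z ^ 3 / 3) / 4)) has_field_derivative
        - 2 * \<i> * z / (F_denom 2 z)\<^sup>2) (at z)"
      by (rule DERIV_cmult[THEN DERIV_cong]) simp
  qed (simp_all add: weierstrass_simps zero cayley_def)
  have F: "F_c 2 z = (1 - w\<^sup>2) / 4"
    unfolding F_c_def dn[OF z] w_def pm(2)[OF z] by simp
  have "Im (F_c 2 z) = - Im (w\<^sup>2) / 4"
    unfolding F by simp
  with W1 W3 show ?thesis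
    by (simp add: lift_eq_weierstrass[OF z] vec_eq_iff forall_3 weierstrass_simps(2) diff_divide_distrib)
qed

text \<open>In complex notation the first two coordinates of \<open>Y2 \<zeta>\<close> are \<open>\<zeta> - cnj \<zeta> ^ 3 / 3\<close>, while the
  first and third of the lift are \<open>w + cnj w ^ 3 / 3\<close> up to scaling and translation. The substitution
  \<open>\<zeta> = e * w\<close> with \<open>e = exp (\<i> * pi / 4)\<close> matches the signs because \<open>e ^ 4 = -1\<close>.\<close>

lemma lift_2_part_of_enneper: "is_part_of (lift h g ` ball 0 1) enneper"
proof -
  define s where "s = 1 / sqrt 2"
  have s: "s * s = 1 / 2" by (simp add: s_def)
  \<comment> \<open>Multiplication of x_1 + i x_3 by exp (i pi/4), with x_2 moved to the last place;
    the translation \<open>a\<close> cancels the constant 1/3 of the first coordinate.\<close>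
  define R where "R x = (vector [s * (x $ 1 - x $ 3), s * (x $ 1 + x $ 3), x $ 2] :: real^3)"
    for x :: "real^3"
  define a where "a = (vector [4 / 3 * s, 4 / 3 * s, 0] :: real^3)"
  have R: "orthogonal_transformation R"
    unfolding orthogonal_transformation_def
  proof (intro conjI allI)
    show "linear R"
      by (auto intro!: linearI simp: R_def vec_eq_iff forall_3 algebra_simps)
    fix v w
    have "R v \<bullet> R w = (s * s) * (2 * (v $ 1 * w $ 1 + v $ 3 * w $ 3)) + v $ 2 * w $ 2"
      by (simp add: R_def inner_vec_def sum_3 algebra_simps)
    then show "R v \<bullet> R w = v \<bullet> w"
      by (simp add: s inner_vec_def sum_3)
  qed
  have "a + (-4) *\<^sub>R R (lift h g z) \<in> enneper" if z: "z \<in> ball 0 1" for z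
  proof -
    define w where "w = cayley z"
    define e where "e = of_real s * (1 + \<i>)"
    have e2: "e\<^sup>2 = \<i>"
      by (simp add: e_def complex_eq_iff power2_eq_square s flip: mult.assoc)
    have e3: "e ^ 3 = of_real s * (\<i> - 1)"
      by (simp add: power3_eq_cube e2[unfolded power2_eq_square]) (simp add: e_def algebra_simps)
    have "a + (-4) *\<^sub>R R (lift h g z) = Y2 (e * w)"
      unfolding lift_2_eq[OF z] Y2_def w_def[symmetric] power_mult_distrib e2 e3
      by (simp add: R_def a_def vec_eq_iff forall_3 e_def field_simps)
    then show ?thesis by (simp add: enneper_def)
  qed
  then show ?thesis
    unfolding is_part_of_def using similarity_scaled[OF _ R, of "-4" a] by (intro exI conjI) auto
qed

lemma f_2_image: "f ` ball 0 1 = - (complex_of_real ` {1 / 3..})"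
proof -
  define T where "T w = Complex (1 / 3 - Re (w + w ^ 3 / 3) / 4) (- Im (w\<^sup>2) / 4)" for w
  have T: "T (Complex a b) = Complex (1 / 3 - (a + a ^ 3 / 3 - a * b\<^sup>2) / 4) (- (a * b) / 2)" for a b
  proof -
    have "Complex a b ^ 3 = Complex (a ^ 3 - 3 * a * b\<^sup>2) (3 * a\<^sup>2 * b - b ^ 3)"
      by (simp add: complex_eq_iff power2_eq_square power3_eq_cube algebra_simps)
    then show ?thesis
      by (simp add: T_def power2_eq_square field_simps)
  qed
  have "f z = T (cayley z)" if "z \<in> ball 0 1" for z
    by (simp only: lift_over_f[OF that, symmetric] lift_2_eq[OF that] vector_3 T_def)
  then have "f ` ball 0 1 = T ` cayley ` ball 0 1"
    unfolding image_image by (rule image_cong[OF refl])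
  also have "\<dots> = T ` {w. Re w > 0}"
    by (simp only: cayley_image_ball)
  also have "\<dots> = - (complex_of_real ` {1 / 3..})"
  proof (intro equalityI subsetI)
    fix p assume "p \<in> T ` {w. Re w > 0}"
    then obtain a b where ab: "a > 0" "p = T (Complex a b)"
      by (metis (mono_tags, lifting) complex.collapse imageE mem_Collect_eq)
    show "p \<in> - (complex_of_real ` {1 / 3..})"
    proof
      assume "p \<in> complex_of_real ` {1 / 3..}"
      \<comment> \<open>A real value has ab = 0 with a > 0; lying at or beyond 1/3 then makes a +
        a^3/3 nonpositive.\<close>
      then have "b = 0" "a + a ^ 3 / 3 - a * b\<^sup>2 \<le> 0"
        using ab by (auto simp: T complex_eq_iff)
      moreover have "a ^ 3 > 0" using ab(1) by simp
      ultimately show False using ab(1) by simp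
    qed
  next
    fix p assume p: "p \<in> - (complex_of_real ` {1 / 3..})"
    \<comment> \<open>\<open>r\<close> and \<open>s\<close> are the values that a + a^3/3 - ab^2 and
      ab must take; eliminating b = s/a leaves one equation for a > 0.\<close>
    define r where "r = 4 / 3 - 4 * Re p"
    define s where "s = - 2 * Im p"
    have "\<exists>a>0. a + a ^ 3 / 3 - s\<^sup>2 / a = r"
    proof (cases "s = 0")
      case True
      then have "p = of_real (Re p)" by (simp add: s_def complex_eq_iff)
      with p have "Re p \<notin> {1 / 3..}" by (metis ComplD imageI)
      then have r: "r > 0" by (simp add: r_def)
      have "\<exists>a\<ge>0. a \<le> r \<and> a + a ^ 3 / 3 = r"
        using r by (intro IVT' continuous_intros) auto
      then obtain a where "a \<ge> 0" "a + a ^ 3 / 3 = r" by blast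
      with r True show ?thesis
        by (intro exI[of _ a]) (cases "a = 0"; simp)
    next
      case False
      \<comment> \<open>Multiplied by a, the equation becomes a quartic with value -s^2 < 0 at 0;
        \<open>M\<close> is chosen so that M^2 already dominates rM + s^2.\<close>
      define M where "M = 1 + \<bar>r\<bar> + \<bar>s\<bar>"
      let ?\<psi> = "\<lambda>a. a\<^sup>2 + a ^ 4 / 3 - r * a - s\<^sup>2"
      have "\<exists>a\<ge>0. a \<le> M \<and> ?\<psi> a = 0"
      proof (rule IVT')
        have "M \<ge> 0" by (simp add: M_def)
        have "r * M \<le> \<bar>r\<bar> * M" using \<open>M \<ge> 0\<close> by (intro mult_right_mono) auto
        moreover have "s\<^sup>2 \<le> \<bar>s\<bar> * M"
          unfolding M_def by (simp add: power2_eq_square algebra_simps)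
        moreover have "M\<^sup>2 = M + \<bar>r\<bar> * M + \<bar>s\<bar> * M"
          by (simp add: M_def power2_eq_square algebra_simps)
        moreover have "M ^ 4 \<ge> 0" by simp
        ultimately show "0 \<le> ?\<psi> M" using \<open>M \<ge> 0\<close> by linarith
        show "0 \<le> M" by fact
      qed (auto intro!: continuous_intros)
      then obtain a where a: "a \<ge> 0" "?\<psi> a = 0" by blast
      moreover have "a \<noteq> 0" using a(2) False by auto
      ultimately show ?thesis
        by (intro exI[of _ a]) (auto simp: field_simps power2_eq_square power3_eq_cube power4_eq_xxxx)
    qed
    then obtain a where a: "a > 0" "a + a ^ 3 / 3 - s\<^sup>2 / a = r" by blast
    have "a + a ^ 3 / 3 - a * (s / a)\<^sup>2 = r" "a * (s / a) = s"
      using a by (simp_all add: power2_eq_square)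
    then have "p = T (Complex a (s / a))"
      unfolding T by (simp add: complex_eq_iff r_def s_def diff_divide_distrib)
    with a(1) show "p \<in> T ` {w. Re w > 0}" by auto
  qed
  finally show ?thesis .
qed

end

section \<open>The case c = -2 by reflection\<close>

context
  fixes h g :: "complex \<Rightarrow> complex"
  assumes shear: "F_c_shear (-2) h g"
begin

interpretation F_c_shear "-2" h g by (rule shear)

lemma reflected_2: "F_c_shear 2 (\<lambda>z. - h (- z)) (\<lambda>z. - g (- z))"
  using reflected by simp

lemma lift_minus_2_part_of_enneper: "is_part_of (lift h g ` ball 0 1) enneper"
proof -
  \<comment> \<open>The half-turn about the third axis, which relates the lifts for c = 2 and c =
    -2.\<close>
  define R where "R x = (vector [- x $ 1, - x $ 2, x $ 3] :: real^3)" for x :: "real^3"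
  have R: "orthogonal_transformation R"
    unfolding orthogonal_transformation_def
    by (auto intro!: linearI simp: R_def vec_eq_iff forall_3 inner_vec_def sum_3)
  have RR: "R (R x) = x" for x
    by (simp add: R_def vec_eq_iff forall_3)
  let ?L = "lift (\<lambda>z. - h (- z)) (\<lambda>z. - g (- z))"
  have "lift h g z = R (?L (- z))" if "z \<in> ball 0 1" for z
    using lift_reflected[of "- z"] that by (simp add: RR flip: R_def)
  then have "lift h g ` ball 0 1 = R ` ?L ` uminus ` ball 0 1"
    unfolding image_image by (rule image_cong[OF refl])
  also have "uminus ` ball 0 1 = (ball 0 1 :: complex set)"
    using unimodular_mult_image_ball[of "- 1" 1] by simp
  finally show ?thesis
    using is_part_of_orthogonal_image[OF R RR lift_2_part_of_enneper[OF reflected_2]] by simp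
qed

lemma f_minus_2_image: "f ` ball 0 1 = - (complex_of_real ` {..- (1 / 3)})"
proof -
  let ?f = "harmonic_map (\<lambda>z. - h (- z)) (\<lambda>z. - g (- z))"
  have "f ` ball 0 1 = uminus ` ?f ` uminus ` ball 0 1"
    by (simp add: image_image harmonic_map_reflected)
  also have "uminus ` ball 0 1 = (ball 0 1 :: complex set)"
    using unimodular_mult_image_ball[of "- 1" 1] by simp
  also have "uminus ` ?f ` ball 0 1 = uminus ` (- (complex_of_real ` {1 / 3..}))"
    by (simp only: f_2_image[OF reflected_2])
  also have "\<dots> = - (complex_of_real ` uminus ` {1 / 3..})"
    by (simp only: bij_image_Compl_eq[OF bij_uminus] image_image of_real_minus)
  also have "uminus ` {1 / 3..} = {..- (1 / 3 :: real)}"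
    by simp
  finally show ?thesis .
qed

end

text \<open>The first conjunct provides the shears over which the second quantifies, so the latter
  is not vacuous.\<close>

theorem theorem5:
  "(\<forall>c\<in>{-2..2::real}. \<exists>h g. horizontal_shear (F_c c) (\<lambda>z. z\<^sup>2) h g) \<and>
   (\<forall>(h :: real \<Rightarrow> complex \<Rightarrow> complex) (g :: real \<Rightarrow> complex \<Rightarrow> complex).
      (\<forall>c\<in>{-2..2}. horizontal_shear (F_c c) (\<lambda>z. z\<^sup>2) (h c) (g c)) \<longrightarrow>
      (let f = (\<lambda>c. harmonic_map (h c) (g c));
           X = (\<lambda>c. lift (h c) (g c))
       in (\<forall>c\<in>{-2..2}. f c \<in> S_H_0 \<and> convex_in_horizontal_direction (f c ` ball 0 1)) \<and>
          (vertical_strip (f 0 ` ball 0 1) \<and>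
           plane_slit_positive (f 2 ` ball 0 1) \<and>
           plane_slit_negative (f (-2) ` ball 0 1)) \<and>
          (\<forall>c\<in>{-2..2}. \<exists>S. minimal_graph (f c ` ball 0 1) S \<and> parametrizes (X c) (ball 0 1) S) \<and>
          (is_part_of (X (-2) ` ball 0 1) enneper \<and>
           is_part_of (X 0 ` ball 0 1) helicoid \<and>
           is_part_of (X 2 ` ball 0 1) enneper)))"
proof (intro conjI allI impI ballI ex_horizontal_shear_F_c)
  fix h g :: "real \<Rightarrow> complex \<Rightarrow> complex"
  assume "\<forall>c\<in>{-2..2}. horizontal_shear (F_c c) (\<lambda>z. z\<^sup>2) (h c) (g c)"
  then have sh: "F_c_shear c (h c) (g c)" if "c \<in> {-2..2}" for c
    using that by unfold_locales auto
  then have sh0: "F_c_shear 0 (h 0) (g 0)" and sh2: "F_c_shear 2 (h 2) (g 2)"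
    and sh_2: "F_c_shear (-2) (h (-2)) (g (-2))"
    by auto
  have "vertical_strip (harmonic_map (h 0) (g 0) ` ball 0 1)"
    unfolding vertical_strip_def f_0_image[OF sh0]
    by (intro exI[of _ "- pi / 4"] exI[of _ "pi / 4"]) simp
  moreover have "plane_slit_positive (harmonic_map (h 2) (g 2) ` ball 0 1)"
    unfolding plane_slit_positive_def f_2_image[OF sh2]
    by (intro exI[of _ "1 / 3"]) simp
  moreover have "plane_slit_negative (harmonic_map (h (-2)) (g (-2)) ` ball 0 1)"
    unfolding plane_slit_negative_def f_minus_2_image[OF sh_2]
    by (intro exI[of _ "- (1 / 3)"]) simp
  moreover have "\<exists>S. minimal_graph (harmonic_map (h c) (g c) ` ball 0 1) S \<and>
      parametrizes (lift (h c) (g c)) (ball 0 1) S" if "c \<in> {-2..2}" for c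
    using F_c_shear.minimal_graph_lift[OF sh[OF that]] F_c_shear.parametrizes_lift[OF sh[OF that]]
    by blast
  ultimately show "let f = (\<lambda>c. harmonic_map (h c) (g c));
           X = (\<lambda>c. lift (h c) (g c))
       in (\<forall>c\<in>{-2..2}. f c \<in> S_H_0 \<and> convex_in_horizontal_direction (f c ` ball 0 1)) \<and>
          (vertical_strip (f 0 ` ball 0 1) \<and>
           plane_slit_positive (f 2 ` ball 0 1) \<and>
           plane_slit_negative (f (-2) ` ball 0 1)) \<and>
          (\<forall>c\<in>{-2..2}. \<exists>S. minimal_graph (f c ` ball 0 1) S \<and> parametrizes (X c) (ball 0 1) S) \<and>
          (is_part_of (X (-2) ` ball 0 1) enneper \<and>
           is_part_of (X 0 ` ball 0 1) helicoid \<and>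
           is_part_of (X 2 ` ball 0 1) enneper)"
    using F_c_shear.f_in_S_H_0[OF sh] F_c_shear.convex_in_horizontal_direction_f[OF sh]
      lift_minus_2_part_of_enneper[OF sh_2] lift_0_part_of_helicoid[OF sh0]
      lift_2_part_of_enneper[OF sh2]
    unfolding Let_def by blast
qed

end
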